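(* Let $T$ be a task and let all data be fixed in a task-consistent snapshot. Let $U_{\max}$ be a real number with $0\le\overline U_T(j)\le U_{\max}$ for all $j$, and assume $\Psi_s^*(T)>0$. Suppose that: (i) the source table is TTL-complete within $H_{\rm ctrl}$ hops, i.e. $\mathcal V_{s_T}^H=\{j\in V_{\rm svc}:h(s_T,j)\le H_{\rm ctrl}\}$ with $h_{s_T}(j)=h(s_T,j)$ for all $j\in\mathcal V_{s_T}^H$; (ii) every forwarding step satisfies next-hop closure: at each nonterminal step of SPFR from $i$ to $k=next_i(j)$ with $j=j_i^{\rm dom}\ne i$, one has $j\in\mathcal V_k^H$ and $h_k(j)=h_i(j)-1$; (iii) $\mathcal E_{s_T}^{H,+}(T)\ne\emptyset$. Define $$V_T^*=\max\{\overline U_T(j)\exp[-\omega_h h(s_T,j)]: j\in\mathcal A_T^0,\ h(s_T,j)\le H_{\rm ctrl}\}.$$ If SPFR started at $s_T$ terminates at executor $m$, then $$\overline U_T(m)\exp[-\omega_h h(s_T,m)]\ge V_T^*.$$ Furthermore, $$0\le \mathrm{P2Gap}_T\le U_{\max}\exp[-\omega_h(H_{\rm ctrl}+1)],$$ where $\mathrm{P2Gap}_T=\Psi_s^*(T)-\overline U_T(m)\exp[-\omega_h h(s_T,m)]$.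
   Context: Snapshot. All data below come from one consistent control-plane snapshot and stay fixed while task $T$ is processed. $G=(V,E)$ is the finite undirected graph of agents in the snapshot; $h(i,j)$ is the shortest-hop distance in $G$ ($\infty$ if disconnected, with $\exp(-\infty)=0$). $V_{\rm svc}\subseteq V$ is the set of service-capable agents. Utility and eligibility. Each $j\in V_{\rm svc}$ has $p_j$ capabilities, a state (active/inactive), trust $\tau_j\in[0,1]$, queue $Q_j\ge0$, service rate $\mu_j>0$, unit price $\pi^{\rm unit}_j\ge0$. Task $T$ has source $s_T\in V$, $m_T\ge1$ requirements, workload $\ell_T\ge0$, threshold $\theta_T$, minimum trust $\tau_T^{\min}$, budget $B_T$, deadline $D_T^{\max}$. $M_{ab}(j,T)\in[0,1]$ is the similarity of capability $a$ of $j$ with requirement $b$. $\mathcal X_j(T)$ is the set of binary matrices $[x_{ab}]$ with $\sum_a x_{ab}=1$ for each $b$, $\sum_b x_{ab}\le1$ for each $a$, and $x_{ab}=0$ if $M_{ab}(j,T)<\theta_T$. If $\mathcal X_j(T)=\emptyset$ then $\chi_j^{\rm cap}(T)=S(j,T)=0$; else $\chi_j^{\rm cap}(T)=1$ and $S(j,T)=m_T^{-1}\max_{\mathbf x\in\mathcal X_j(T)}\sum_{a,b}x_{ab}M_{ab}(j,T)$. With constants $\Delta_{\rm ref},\Pi_{\rm ref}>0$ and weights $w_s,w_l,w_p\ge0$ summing to 1: $D_j^{\rm exec}(T)=(Q_j+\ell_T)/\mu_j$, $\rho_j^T=\min\{(Q_j+\ell_T)/(\mu_j\Delta_{\rm ref}),1\}$,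 $\pi_j(T)=\pi_j^{\rm unit}\ell_T$, $\widetilde\pi_j(T)=\min\{\pi_j(T)/\Pi_{\rm ref},1\}$, and $U_T(j)=w_sS(j,T)+w_l(1-\rho_j^T)+w_p(1-\widetilde\pi_j(T))\in[0,1]$. Given return-route data $valid_j^{\rm ret}(s_T)\in\{0,1\}$, $K_j^{\rm ret}(s_T)\ge0$, $D_j^{\rm ret}(s_T)\ge0$, the eligible set $\mathcal A_T^0\subseteq V_{\rm svc}$ consists of the active $j\in V_{\rm svc}$ with $\chi_j^{\rm cap}(T)=1$, $\rho_j^T<1$, $\tau_j\ge\tau_T^{\min}$, $valid_j^{\rm ret}(s_T)=1$, $\pi_j(T)+K_j^{\rm ret}(s_T)\le B_T$, $D_j^{\rm exec}(T)+D_j^{\rm ret}(s_T)\le D_T^{\max}$. The gated utility is $\overline U_T(j)=U_T(j)$ if $j\in\mathcal A_T^0$ and $0$ otherwise. Local tables. $H_{\rm ctrl}\in\mathbb Z_{\ge0}$ is the control horizon. Each agent $i$ has a set $\mathcal V_i^H\subseteq V_{\rm svc}$ of visible service agents, and for each $j\in\mathcal V_i^H$ a stored hop distance $h_i(j)$ and a next hop $next_i(j)$. If $i\in V_{\rm svc}$ then $i\in\mathcal V_i^H$, $h_i(i)=0$ and $next_i(i)=i$; for $j\ne i$, $next_i(j)$ is a neighbor of $i$ in $G$. Potentials. Fix $\omega_h>0$. For $j\in\mathcal V_i^H$, $\phi_i(j,T)=\overline U_T(j)\exp[-\omega_h h_i(j)]$. Let $\mathcal E_i^H(T)=\mathcal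 A_T^0\cap\mathcal V_i^H$ and $\mathcal E_i^{H,+}(T)=\{j\in\mathcal E_i^H(T):\overline U_T(j)>0\}$. The global hop-regularized objective value is $\Psi_s^*(T)=\max_{j\in\mathcal A_T^0}\overline U_T(j)\exp[-\omega_h h(s_T,j)]$, with $\max\emptyset=0$. SPFR (frozen rule). Start at $i=s_T$. At the current agent $i$: if $\mathcal E_i^{H,+}(T)=\emptyset$, stop and return "no route". Otherwise let $j_i^{\rm dom}$ be a maximizer of $\phi_i(\cdot,T)$ over $\mathcal E_i^{H,+}(T)$, ties broken deterministically by a fixed total order on agent identifiers. If $j_i^{\rm dom}=i$, terminate with $i$ as executor. Otherwise, if $|V|-1$ forwarding steps have already been made, return "no route"; else make a nonterminal forwarding step to $next_i(j_i^{\rm dom})$ (forwarding over a link of $G$ succeeds in the frozen analysis) and repeat. *)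

theory Defs
  imports "Graph_Theory.Shortest_Path" "Jordan_Normal_Form.Matrix"
begin

record ('a, 'e) snapshot =
  network :: "('a, 'e) pre_digraph"
  service :: "'a set"
  num_caps :: "'a \<Rightarrow> nat"
  active :: "'a \<Rightarrow> bool"
  trust :: "'a \<Rightarrow> real"
  queue :: "'a \<Rightarrow> real"
  rate :: "'a \<Rightarrow> real"
  unit_price :: "'a \<Rightarrow> real"
  delay_ref :: real
  price_ref :: real
  weight_s :: real
  weight_l :: real
  weight_p :: real
  ret_valid :: "'a \<Rightarrow> 'a \<Rightarrow> bool"   (* executor, then source; likewise below *)
  ret_cost :: "'a \<Rightarrow> 'a \<Rightarrow> real"
  ret_delay :: "'a \<Rightarrow> 'a \<Rightarrow> real"
  horizon :: nat
  visible :: "'a \<Rightarrow> 'a set"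
  stored_hops :: "'a \<Rightarrow> 'a \<Rightarrow> nat"
  next_hop :: "'a \<Rightarrow> 'a \<Rightarrow> 'a"
  hop_weight :: real
  tie_order :: "'a rel"

record 'a task =
  source :: 'a
  num_reqs :: nat
  workload :: real
  sim_threshold :: real
  min_trust :: real
  budget :: real
  deadline :: real
  similarity :: "'a \<Rightarrow> real mat"   (* rows: capabilities of the agent, columns: requirements *)

text \<open>Undirected graphs are symmetric digraphs without loops or parallel arcs (locale \<open>graph\<close>).\<close>

locale task_snapshot = graph "network S"
  for S :: "('a, 'e) snapshot" and T :: "'a task" +
  assumes service_subset: "service S \<subseteq> verts (network S)"
    and trust_range: "\<And>j. j \<in> service S \<Longrightarrow> 0 \<le> trust S j \<and> trust S j \<le> 1"
    and queue_nonneg: "\<And>j. j \<in> service S \<Longrightarrow> 0 \<le> queue S j"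
    and rate_pos: "\<And>j. j \<in> service S \<Longrightarrow> 0 < rate S j"
    and unit_price_nonneg: "\<And>j. j \<in> service S \<Longrightarrow> 0 \<le> unit_price S j"
    and refs_pos: "0 < delay_ref S" "0 < price_ref S"
    and weights_nonneg: "0 \<le> weight_s S" "0 \<le> weight_l S" "0 \<le> weight_p S"
    and weights_sum: "weight_s S + weight_l S + weight_p S = 1"
    and source_in_verts: "source T \<in> verts (network S)"
    and num_reqs_pos: "1 \<le> num_reqs T"
    and workload_nonneg: "0 \<le> workload T"
    and similarity_dim:
      "\<And>j. j \<in> service S \<Longrightarrow> similarity T j \<in> carrier_mat (num_caps S j) (num_reqs T)"
    and similarity_range:
      "\<And>j a b. j \<in> service S \<Longrightarrow> a < num_caps S j \<Longrightarrow> b < num_reqs T \<Longrightarrow>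
         0 \<le> similarity T j $$ (a, b) \<and> similarity T j $$ (a, b) \<le> 1"
    and ret_cost_nonneg: "\<And>j. j \<in> service S \<Longrightarrow> 0 \<le> ret_cost S j (source T)"
    and ret_delay_nonneg: "\<And>j. j \<in> service S \<Longrightarrow> 0 \<le> ret_delay S j (source T)"
    and visible_subset: "\<And>i. i \<in> verts (network S) \<Longrightarrow> visible S i \<subseteq> service S"
    and self_entry: "\<And>i. i \<in> service S \<Longrightarrow>
      i \<in> visible S i \<and> stored_hops S i i = 0 \<and> next_hop S i i = i"
    and next_hop_neighbor: "\<And>i j. i \<in> verts (network S) \<Longrightarrow> j \<in> visible S i \<Longrightarrow> j \<noteq> i \<Longrightarrow>
      (i, next_hop S i j) \<in> arcs_ends (network S)"
    and hop_weight_pos: "0 < hop_weight S"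
    and tie_order_linear: "linear_order_on (verts (network S)) (tie_order S)"

text \<open>Shortest-path cost for unit arc costs, i.e. the least number of arcs of a walk;
  it is \<open>\<infinity>\<close> when there is no walk.\<close>

definition hop_dist :: "('a, 'e) snapshot \<Rightarrow> 'a \<Rightarrow> 'a \<Rightarrow> ereal" where
  "hop_dist S i j = wf_digraph.\<mu> (network S) (\<lambda>_. 1) i j"

text \<open>\<open>exp (- \<omega> d)\<close> for an extended hop distance, with \<open>exp (- \<infinity>) = 0\<close>.\<close>

definition hop_discount :: "('a, 'e) snapshot \<Rightarrow> ereal \<Rightarrow> real" where
  "hop_discount S d = (if d = \<infinity> then 0 else exp (- (hop_weight S * real_of_ereal d)))"

definition Max0 :: "real set \<Rightarrow> real" where
  "Max0 A = (if A = {} then 0 else Max A)"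

definition assignments :: "('a, 'e) snapshot \<Rightarrow> 'a task \<Rightarrow> 'a \<Rightarrow> real mat set" where
  "assignments S T j = {x \<in> carrier_mat (num_caps S j) (num_reqs T).
     (\<forall>a < num_caps S j. \<forall>b < num_reqs T. x $$ (a, b) \<in> {0, 1}) \<and>
     (\<forall>b < num_reqs T. (\<Sum>a < num_caps S j. x $$ (a, b)) = 1) \<and>
     (\<forall>a < num_caps S j. (\<Sum>b < num_reqs T. x $$ (a, b)) \<le> 1) \<and>
     (\<forall>a < num_caps S j. \<forall>b < num_reqs T.
        similarity T j $$ (a, b) < sim_threshold T \<longrightarrow> x $$ (a, b) = 0)}"

definition cap_match :: "('a, 'e) snapshot \<Rightarrow> 'a task \<Rightarrow> 'a \<Rightarrow> nat" where
  "cap_match S T j = (if assignments S T j = {} then 0 else 1)"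

definition match_score :: "('a, 'e) snapshot \<Rightarrow> 'a task \<Rightarrow> 'a \<Rightarrow> real" where
  "match_score S T j = (if assignments S T j = {} then 0 else
     Max ((\<lambda>x. \<Sum>a < num_caps S j. \<Sum>b < num_reqs T. x $$ (a, b) * similarity T j $$ (a, b))
            ` assignments S T j) / real (num_reqs T))"

definition exec_delay :: "('a, 'e) snapshot \<Rightarrow> 'a task \<Rightarrow> 'a \<Rightarrow> real" where
  "exec_delay S T j = (queue S j + workload T) / rate S j"

definition norm_load :: "('a, 'e) snapshot \<Rightarrow> 'a task \<Rightarrow> 'a \<Rightarrow> real" where
  "norm_load S T j = min ((queue S j + workload T) / (rate S j * delay_ref S)) 1"

definition price :: "('a, 'e) snapshot \<Rightarrow> 'a task \<Rightarrow> 'a \<Rightarrow> real" where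
  "price S T j = unit_price S j * workload T"

definition norm_price :: "('a, 'e) snapshot \<Rightarrow> 'a task \<Rightarrow> 'a \<Rightarrow> real" where
  "norm_price S T j = min (price S T j / price_ref S) 1"

definition utility :: "('a, 'e) snapshot \<Rightarrow> 'a task \<Rightarrow> 'a \<Rightarrow> real" where
  "utility S T j = weight_s S * match_score S T j + weight_l S * (1 - norm_load S T j)
     + weight_p S * (1 - norm_price S T j)"

definition eligible :: "('a, 'e) snapshot \<Rightarrow> 'a task \<Rightarrow> 'a set" where
  "eligible S T = {j \<in> service S. active S j \<and> cap_match S T j = 1 \<and> norm_load S T j < 1 \<and>
     min_trust T \<le> trust S j \<and> ret_valid S j (source T) \<and>
     price S T j + ret_cost S j (source T) \<le> budget T \<and>
     exec_delay S T j + ret_delay S j (source T) \<le> deadline T}"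

definition gated_utility :: "('a, 'e) snapshot \<Rightarrow> 'a task \<Rightarrow> 'a \<Rightarrow> real" where
  "gated_utility S T j = (if j \<in> eligible S T then utility S T j else 0)"

definition potential :: "('a, 'e) snapshot \<Rightarrow> 'a task \<Rightarrow> 'a \<Rightarrow> 'a \<Rightarrow> real" where
  "potential S T i j = gated_utility S T j * exp (- (hop_weight S * real (stored_hops S i j)))"

definition local_eligible :: "('a, 'e) snapshot \<Rightarrow> 'a task \<Rightarrow> 'a \<Rightarrow> 'a set" where
  "local_eligible S T i = eligible S T \<inter> visible S i"

definition local_eligible_pos :: "('a, 'e) snapshot \<Rightarrow> 'a task \<Rightarrow> 'a \<Rightarrow> 'a set" where
  "local_eligible_pos S T i = {j \<in> local_eligible S T i. 0 < gated_utility S T j}"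

definition global_value :: "('a, 'e) snapshot \<Rightarrow> 'a task \<Rightarrow> 'a \<Rightarrow> real" where
  "global_value S T j = gated_utility S T j * hop_discount S (hop_dist S (source T) j)"

definition Psi_star :: "('a, 'e) snapshot \<Rightarrow> 'a task \<Rightarrow> real" where
  "Psi_star S T = Max0 (global_value S T ` eligible S T)"

definition V_star :: "('a, 'e) snapshot \<Rightarrow> 'a task \<Rightarrow> real" where
  "V_star S T = Max0 (global_value S T `
     {j \<in> eligible S T. hop_dist S (source T) j \<le> ereal (real (horizon S))})"

definition P2Gap :: "('a, 'e) snapshot \<Rightarrow> 'a task \<Rightarrow> 'a \<Rightarrow> real" where
  "P2Gap S T m = Psi_star S T - global_value S T m"

text \<open>Among the maximizers the least one with respect to \<open>tie_order\<close> is taken; this is no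
  restriction on the tie-breaking convention since \<open>tie_order\<close> is an arbitrary linear order.\<close>

definition dominant :: "('a, 'e) snapshot \<Rightarrow> 'a task \<Rightarrow> 'a \<Rightarrow> 'a" where
  "dominant S T i = (THE j.
     is_arg_max (potential S T i) (\<lambda>k. k \<in> local_eligible_pos S T i) j \<and>
     (\<forall>k. is_arg_max (potential S T i) (\<lambda>k. k \<in> local_eligible_pos S T i) k \<longrightarrow>
        (j, k) \<in> tie_order S))"

text \<open>\<open>spfr_at S T n i\<close>: the run started at the source is at agent \<open>i\<close> after \<open>n\<close> forwarding
  steps.  \<open>spfr_returns S T r\<close>: the run ends, with executor \<open>m\<close> if \<open>r = Some m\<close> and with
  no route if \<open>r = None\<close>.\<close>

inductive spfr_at :: "('a, 'e) snapshot \<Rightarrow> 'a task \<Rightarrow> nat \<Rightarrow> 'a \<Rightarrow> bool"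
  for S :: "('a, 'e) snapshot" and T :: "'a task" where
  start: "spfr_at S T 0 (source T)"
| forward: "spfr_at S T n i \<Longrightarrow> local_eligible_pos S T i \<noteq> {} \<Longrightarrow> dominant S T i \<noteq> i \<Longrightarrow>
    n < card (verts (network S)) - 1 \<Longrightarrow>
    spfr_at S T (Suc n) (next_hop S i (dominant S T i))"

inductive spfr_returns :: "('a, 'e) snapshot \<Rightarrow> 'a task \<Rightarrow> 'a option \<Rightarrow> bool"
  for S :: "('a, 'e) snapshot" and T :: "'a task" where
  none_eligible: "spfr_at S T n i \<Longrightarrow> local_eligible_pos S T i = {} \<Longrightarrow> spfr_returns S T None"
| executor: "spfr_at S T n i \<Longrightarrow> local_eligible_pos S T i \<noteq> {} \<Longrightarrow> dominant S T i = i \<Longrightarrow>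
    spfr_returns S T (Some i)"
| exhausted: "spfr_at S T n i \<Longrightarrow> local_eligible_pos S T i \<noteq> {} \<Longrightarrow> dominant S T i \<noteq> i \<Longrightarrow>
    n \<ge> card (verts (network S)) - 1 \<Longrightarrow> spfr_returns S T None"

definition ttl_complete_source :: "('a, 'e) snapshot \<Rightarrow> 'a task \<Rightarrow> bool" where
  "ttl_complete_source S T \<longleftrightarrow>
     visible S (source T) =
       {j \<in> service S. hop_dist S (source T) j \<le> ereal (real (horizon S))} \<and>
     (\<forall>j \<in> visible S (source T).
        ereal (real (stored_hops S (source T) j)) = hop_dist S (source T) j)"

text \<open>The decrement is stated over \<open>int\<close>: truncated subtraction would admit a stored distance \<open>0\<close>
  at both ends of a forwarding step.\<close>

definition next_hop_closure :: "('a, 'e) snapshot \<Rightarrow> 'a task \<Rightarrow> bool" where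
  "next_hop_closure S T \<longleftrightarrow>
     (\<forall>n i j k. spfr_at S T n i \<and> local_eligible_pos S T i \<noteq> {} \<and>
        j = dominant S T i \<and> j \<noteq> i \<and> n < card (verts (network S)) - 1 \<and> k = next_hop S i j \<longrightarrow>
        j \<in> visible S k \<and> int (stored_hops S k j) = int (stored_hops S i j) - 1)"

end

theory Submission
  imports Defs
begin

text \<open>Next-hop closure makes the dominant potential grow by a factor \<open>exp \<omega>\<close> at every forwarding
  step, because the previous dominant agent is still visible and one hop closer.  Starting from at
  least \<open>V\<^sup>*\<close> at the source, it is at least \<open>V\<^sup>* exp (\<omega> n)\<close> after \<open>n\<close> steps.  At the executor \<open>m\<close>
  the dominant potential is the gated utility itself, and \<open>m\<close> lies at most \<open>n\<close> hops from the
  source, so discounting gives back at least \<open>V\<^sup>*\<close>.  An eligible agent which is not counted in \<open>V\<^sup>*\<close>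
  is at least \<open>H + 1\<close> hops away, since hop distances are integers or infinite.\<close>

section \<open>Least elements and unit arc costs\<close>

text \<open>Supplies the tie-break: a nonempty finite set of maximizers has a least member, so the
  description defining \<open>dominant\<close> denotes.\<close>

lemma linear_order_on_finite_least:
  assumes "linear_order_on V r" "finite A" "A \<noteq> {}" "A \<subseteq> V"
  shows "\<exists>x\<in>A. \<forall>y\<in>A. (x, y) \<in> r"
  using assms(2-4)
proof (induction rule: finite_ne_induct)
  case (singleton x)
  then show ?case
    using assms(1)
    by (auto simp: linear_order_on_def partial_order_on_def preorder_on_def dest: refl_onD)
next
  case (insert z F)
  then obtain x where x: "x \<in> F" "\<And>y. y \<in> F \<Longrightarrow> (x, y) \<in> r"
    by auto
  have r: "refl_on V r" "trans r" "total_on V r"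
    using assms(1) by (auto simp: linear_order_on_def partial_order_on_def preorder_on_def)
  have V: "x \<in> V" "z \<in> V"
    using x(1) insert.prems by auto
  show ?case
  proof (cases "(x, z) \<in> r")
    case True
    then show ?thesis using x by auto
  next
    case False
    then have "(z, x) \<in> r"
      using r V by (metis refl_onD total_on_def)
    moreover have "(z, z) \<in> r"
      using r V by (auto dest: refl_onD)
    ultimately show ?thesis
      using x r(2) by (blast dest: transD)
  qed
qed

text \<open>Each walk costs its length, an integer, so the strict bound improves by one for every
  walk and passes to the infimum. Without walks the infimum is infinite.\<close>

lemma (in wf_digraph) unit_cost_ge_Suc:
  assumes "ereal (real n) < \<mu> (\<lambda>_. 1) u v"
  shows "ereal (real (Suc n)) \<le> \<mu> (\<lambda>_. 1) u v"
  unfolding \<mu>_def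
proof (rule INF_greatest)
  fix p assume "p \<in> {p. awalk u p v}"
  then have "\<mu> (\<lambda>_. 1) u v \<le> awalk_cost (\<lambda>_. 1) p"
    by (simp add: min_cost_le_walk_cost)
  moreover have "awalk_cost (\<lambda>_. 1) p = real (length p)"
    by (induction p) auto
  ultimately show "ereal (real (Suc n)) \<le> ereal (awalk_cost (\<lambda>_. 1) p)"
    using less_le_trans[OF assms] by fastforce
qed

context task_snapshot
begin

section \<open>Hop distances and discounts\<close>

lemma hop_dist_nonneg: "0 \<le> hop_dist S i j"
  unfolding hop_dist_def \<mu>_def
  by (rule INF_greatest) (auto simp: pos_cost_pos_awalk_cost)

lemma hop_discount_nonneg: "0 \<le> hop_discount S d"
  by (simp add: hop_discount_def)

text \<open>Nonnegativity of \<open>d\<close> excludes minus infinity, where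
  \<open>real_of_ereal\<close> gives 0 and monotonicity would fail.\<close>

lemma hop_discount_antimono:
  assumes "0 \<le> d" "d \<le> e"
  shows "hop_discount S e \<le> hop_discount S d"
  using assms hop_weight_pos by (cases d; cases e) (auto simp: hop_discount_def)

lemma hop_discount_of_nat:
  "hop_discount S (ereal (real n)) = exp (- (hop_weight S * real n))"
  by (simp add: hop_discount_def)

section \<open>Eligible agents and the dominant agent\<close>

lemma finite_eligible: "finite (eligible S T)"
  using service_subset by (auto simp: eligible_def intro: finite_subset[OF _ finite_verts])

lemma eligible_service: "j \<in> eligible S T \<Longrightarrow> j \<in> service S"
  by (simp add: eligible_def)

lemma local_eligible_posD:
  assumes "j \<in> local_eligible_pos S T i"
  shows "j \<in> eligible S T" "j \<in> visible S i" "0 < gated_utility S T j"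
  using assms by (auto simp: local_eligible_pos_def local_eligible_def)

lemma dominant_is_arg_max:
  assumes "local_eligible_pos S T i \<noteq> {}"
  shows "is_arg_max (potential S T i) (\<lambda>k. k \<in> local_eligible_pos S T i) (dominant S T i)"
proof -
  let ?L = "local_eligible_pos S T i"
  let ?M = "{j. is_arg_max (potential S T i) (\<lambda>k. k \<in> ?L) j}"
  have fin: "finite ?L"
    by (rule finite_subset[OF _ finite_eligible]) (auto dest: local_eligible_posD)
  have arg_max_sub: "?M \<subseteq> ?L"
    by (auto simp: is_arg_max_def)
  have "Max (potential S T i ` ?L) \<in> potential S T i ` ?L"
    using fin assms by (intro Max_in) auto
  then obtain j0 where j0: "j0 \<in> ?L" "Max (potential S T i ` ?L) = potential S T i j0"
    by auto
  then have "potential S T i k \<le> potential S T i j0" if "k \<in> ?L" for k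
    using that fin by (metis Max_ge finite_imageI imageI)
  then have "?M \<noteq> {}"
    using j0(1) by (auto simp: is_arg_max_linorder)
  moreover have "?L \<subseteq> verts (network S)"
    using service_subset by (auto dest!: local_eligible_posD(1) eligible_service)
  ultimately obtain j where j: "j \<in> ?M" "\<And>k. k \<in> ?M \<Longrightarrow> (j, k) \<in> tie_order S"
    using linear_order_on_finite_least[OF tie_order_linear finite_subset[OF arg_max_sub fin]] arg_max_sub by blast
  \<comment> \<open>Two least maximizers coincide by antisymmetry, which is the uniqueness that
    \<open>the_equality\<close> asks for.\<close>
  have "antisym (tie_order S)"
    using tie_order_linear by (simp add: linear_order_on_def partial_order_on_def)
  then have "dominant S T i = j"
    unfolding dominant_def using j by (intro the_equality) (auto dest: antisymD)
  then show ?thesis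
    using j(1) by simp
qed

lemma dominant_in:
  "local_eligible_pos S T i \<noteq> {} \<Longrightarrow> dominant S T i \<in> local_eligible_pos S T i"
  using dominant_is_arg_max by (auto simp: is_arg_max_def)

lemma potential_le_dominant:
  assumes "j \<in> local_eligible_pos S T i"
  shows "potential S T i j \<le> potential S T i (dominant S T i)"
proof -
  have "local_eligible_pos S T i \<noteq> {}"
    using assms by auto
  from dominant_is_arg_max[OF this] show ?thesis
    using assms by (simp add: is_arg_max_linorder)
qed

section \<open>The forwarding run\<close>

lemma spfr_at_walk:
  assumes "spfr_at S T n i"
  shows "\<exists>p. awalk (source T) p i \<and> length p = n"
  using assms
proof induction
  case start
  then show ?case
    using source_in_verts by (auto simp: awalk_Nil_iff)
next
  case (forward n i)
  then obtain p where p: "awalk (source T) p i" "length p = n"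
    by auto
  have "(i, next_hop S i (dominant S T i)) \<in> arcs_ends (network S)"
    using p(1) local_eligible_posD(2)[OF dominant_in] forward.hyps
    by (intro next_hop_neighbor) auto
  then obtain e where "arc e (i, next_hop S i (dominant S T i))"
    by (auto simp: arcs_ends_def arc_to_ends_def arc_def)
  then have "awalk i [e] (next_hop S i (dominant S T i))"
    using arc_implies_awalk[of e] by (auto simp: arc_def)
  then have "awalk (source T) (p @ [e]) (next_hop S i (dominant S T i))"
    by (rule awalk_appendI[OF p(1)])
  then show ?case
    using p(2) by (metis length_append_singleton)
qed

lemma spfr_at_hop_dist:
  assumes "spfr_at S T n i"
  shows "hop_dist S (source T) i \<le> ereal (real n)"
proof -
  obtain p where p: "awalk (source T) p i" "length p = n"
    using spfr_at_walk[OF assms] by auto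
  have "awalk_cost (\<lambda>_. 1) p = real (length p)"
    by (induction p) auto
  then show ?thesis
    using min_cost_le_walk_cost[OF p(1), of "\<lambda>_. 1"] p(2) by (simp add: hop_dist_def)
qed

lemma spfr_at_potential:
  assumes "next_hop_closure S T" "local_eligible_pos S T (source T) \<noteq> {}" "spfr_at S T n i"
  shows "local_eligible_pos S T i \<noteq> {} \<and>
    potential S T i (dominant S T i) \<ge>
      exp (hop_weight S * real n) * potential S T (source T) (dominant S T (source T))"
  using assms(3)
proof induction
  case start
  then show ?case using assms(2) by simp
next
  case (forward n i)
  let ?j = "dominant S T i" and ?P = "potential S T (source T) (dominant S T (source T))"
  let ?k = "next_hop S i ?j"
  have cl: "?j \<in> visible S ?k" "int (stored_hops S ?k ?j) = int (stored_hops S i ?j) - 1"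
    using assms(1) forward.hyps unfolding next_hop_closure_def by blast+
  \<comment> \<open>The decrement over \<open>int\<close> carries over to the reals exactly, with no
    truncation at 0.\<close>
  then have "real (stored_hops S i ?j) = real (stored_hops S ?k ?j) + 1"
    by linarith
  then have pot: "potential S T ?k ?j = exp (hop_weight S) * potential S T i ?j"
    by (simp add: potential_def algebra_simps flip: exp_add)
  \<comment> \<open>Eligibility and gated utility do not depend on the current agent, so visibility
    at \<open>?k\<close> is all that has to be checked. This also keeps the run from meeting an
    empty candidate set.\<close>
  have jk: "?j \<in> local_eligible_pos S T ?k"
    using cl(1) local_eligible_posD[OF dominant_in[OF forward.hyps(2)]]
    by (simp add: local_eligible_pos_def local_eligible_def)
  have "exp (hop_weight S * real (Suc n)) * ?P
      = exp (hop_weight S) * (exp (hop_weight S * real n) * ?P)"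
    by (simp add: algebra_simps exp_add)
  also have "\<dots> \<le> potential S T ?k ?j"
    unfolding pot using forward.IH by (intro mult_left_mono) auto
  also have "\<dots> \<le> potential S T ?k (dominant S T ?k)"
    using jk by (rule potential_le_dominant)
  finally show ?case
    using jk by blast
qed

section \<open>Global values against potentials\<close>

text \<open>Within the horizon a TTL-complete table stores the true distances, so global value and
  source potential agree there.\<close>

lemma global_value_le_source_potential:
  assumes "ttl_complete_source S T" "local_eligible_pos S T (source T) \<noteq> {}"
    and "0 \<le> gated_utility S T j" "j \<in> eligible S T"
    and "hop_dist S (source T) j \<le> ereal (real (horizon S))"
  shows "global_value S T j \<le> potential S T (source T) (dominant S T (source T))"
proof (cases "gated_utility S T j = 0")
  \<comment> \<open>Agents of zero utility are not candidates, so dominance says nothing about them;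
    their value 0 lies below the positive dominant potential.\<close>
  case True
  have "0 < gated_utility S T (dominant S T (source T))"
    using local_eligible_posD(3)[OF dominant_in[OF assms(2)]] .
  then show ?thesis
    using True by (simp add: global_value_def potential_def)
next
  case False
  have vis: "j \<in> visible S (source T)"
    using assms(1,4,5) eligible_service by (auto simp: ttl_complete_source_def)
  then have "hop_dist S (source T) j = ereal (real (stored_hops S (source T) j))"
    using assms(1) by (auto simp: ttl_complete_source_def)
  then have "global_value S T j = potential S T (source T) j"
    by (simp add: global_value_def potential_def hop_discount_of_nat)
  also have "j \<in> local_eligible_pos S T (source T)"
    using vis False assms(3,4) by (simp add: local_eligible_pos_def local_eligible_def)
  then have "potential S T (source T) j \<le> potential S T (source T) (dominant S T (source T))"
    by (rule potential_le_dominant)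
  finally show ?thesis .
qed

lemma executor_global_value:
  assumes "next_hop_closure S T" "local_eligible_pos S T (source T) \<noteq> {}"
    and "spfr_returns S T (Some m)"
  shows "m \<in> eligible S T"
    and "potential S T (source T) (dominant S T (source T)) \<le> global_value S T m"
proof -
  obtain n where n: "spfr_at S T n m" "local_eligible_pos S T m \<noteq> {}" "dominant S T m = m"
    using assms(3) by cases auto
  have m: "m \<in> eligible S T" "0 < gated_utility S T m"
    using local_eligible_posD[OF dominant_in[OF n(2)]] n(3) by auto
  then show "m \<in> eligible S T" by simp
  let ?P = "potential S T (source T) (dominant S T (source T))"
  \<comment> \<open>The self entry stores distance 0, hence no discount.\<close>
  have "potential S T m m = gated_utility S T m"
    using self_entry[OF eligible_service[OF m(1)]] by (simp add: potential_def)
  then have "exp (hop_weight S * real n) * ?P \<le> gated_utility S T m"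
    using spfr_at_potential[OF assms(1,2) n(1)] n(3) by simp
  then have "?P \<le> gated_utility S T m * exp (- (hop_weight S * real n))"
    by (simp add: exp_minus field_simps)
  also have "\<dots> \<le> global_value S T m"
    unfolding global_value_def hop_discount_of_nat[symmetric]
    using m(2) spfr_at_hop_dist[OF n(1)]
    by (intro mult_left_mono hop_discount_antimono hop_dist_nonneg) auto
  finally show "?P \<le> global_value S T m" .
qed

end

theorem theorem5:
  fixes S :: "('a, 'e) snapshot" and T :: "'a task" and U_max :: real and m :: 'a
  assumes "task_snapshot S T"
    and "\<And>j. j \<in> service S \<Longrightarrow> 0 \<le> gated_utility S T j \<and> gated_utility S T j \<le> U_max"
    and "Psi_star S T > 0"
    and "ttl_complete_source S T"
    and "next_hop_closure S T"
    and "local_eligible_pos S T (source T) \<noteq> {}"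
    and "spfr_returns S T (Some m)"
  shows "gated_utility S T m * hop_discount S (hop_dist S (source T) m) \<ge> V_star S T
    \<and> 0 \<le> P2Gap S T m
    \<and> P2Gap S T m \<le> U_max * exp (- (hop_weight S * (real (horizon S) + 1)))"
proof -
  interpret task_snapshot S T by fact
  let ?near = "{j \<in> eligible S T. hop_dist S (source T) j \<le> ereal (real (horizon S))}"
  let ?bound = "U_max * exp (- (hop_weight S * (real (horizon S) + 1)))"
  have U: "0 \<le> gated_utility S T j" "gated_utility S T j \<le> U_max" if "j \<in> eligible S T" for j
    using assms(2) eligible_service[OF that] by auto
  have m: "m \<in> eligible S T"
    using executor_global_value(1)[OF assms(5-7)] .
  have m0: "0 \<le> global_value S T m"
    using U(1)[OF m] hop_discount_nonneg by (simp add: global_value_def)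
  have near: "global_value S T j \<le> global_value S T m" if "j \<in> ?near" for j
    using that U(1) global_value_le_source_potential[OF assms(4,6), of j]
      executor_global_value(2)[OF assms(5-7)] by auto
  \<comment> \<open>\<open>m0\<close> covers the case of an empty \<open>?near\<close>, where
    \<open>Max0\<close> is 0.\<close>
  have V: "V_star S T \<le> global_value S T m"
    using near m0 finite_eligible by (auto simp: V_star_def Max0_def)
  have Psi: "Psi_star S T = Max (global_value S T ` eligible S T)"
    using m by (auto simp: Psi_star_def Max0_def)
  then have gap0: "global_value S T m \<le> Psi_star S T"
    using m finite_eligible by simp
  have "Max (global_value S T ` eligible S T) \<in> global_value S T ` eligible S T"
    using m finite_eligible by (intro Max_in) auto
  then obtain j where j: "j \<in> eligible S T" "Psi_star S T = global_value S T j"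
    using Psi by auto
  have U_max: "0 \<le> U_max"
    using U[OF m] by linarith
  have gap: "Psi_star S T - global_value S T m \<le> ?bound"
  proof (cases "hop_dist S (source T) j \<le> ereal (real (horizon S))")
    \<comment> \<open>An optimum inside the horizon is already matched by \<open>m\<close>.\<close>
    case True
    then have "Psi_star S T - global_value S T m \<le> 0"
      using near j by simp
    also have "0 \<le> ?bound"
      using U_max by simp
    finally show ?thesis .
  next
    case False
    \<comment> \<open>Integrality of hop distances yields the \<open>+ 1\<close> in the exponent of
      \<open>?bound\<close>.\<close>
    then have "ereal (real (Suc (horizon S))) \<le> hop_dist S (source T) j"
      using unit_cost_ge_Suc by (simp add: hop_dist_def not_le)
    then have "hop_discount S (hop_dist S (source T) j)
        \<le> hop_discount S (ereal (real (Suc (horizon S))))"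
      by (intro hop_discount_antimono) auto
    then have "global_value S T j \<le> U_max * hop_discount S (ereal (real (Suc (horizon S))))"
      unfolding global_value_def
      using U[OF j(1)] U_max hop_discount_nonneg by (intro mult_mono) auto
    also have "\<dots> = ?bound"
      unfolding hop_discount_of_nat by (simp add: add.commute)
    \<comment> \<open>The value of \<open>m\<close> is nonnegative by \<open>m0\<close>, so
      subtracting it keeps the bound.\<close>
    finally show ?thesis
      using j(2) m0 by linarith
  qed
  show ?thesis
    using V gap0 gap by (simp add: global_value_def P2Gap_def)
qed

end
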